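(* Let $d\geq2$ and let $\{F_n\}_{n\geq1}$ be a sequence of Hénon maps $F_n(z,w)=(z^d+q_n(z)+\delta_n w,\ z)$, where each $q_n$ is a polynomial of degree at most $d-1$, each $\delta_n\neq0$, and the moduli of all coefficients of the $q_n$ and the $|\delta_n|$ are bounded above by a constant independent of $n$. Then for every $r>0$ the sublevel set \[ \Omega_{\{F_n\},r}=\{(z,w)\in\mathbb{C}^2: G^+_{\{F_n\}}(z,w)<r\} \] is a Short $\mathbb{C}^2$.
   Context: The random Green's function is $G^+_{\{F_n\}}(z,w)=\lim_{n\to\infty}\frac{1}{d^n}\log^+\|F_n\circ\cdots\circ F_1(z,w)\|$ for $(z,w)\in\mathbb{C}^2$, where $\log^+x=\max\{\log x,0\}$; under the stated hypotheses this limit exists at every point. Definition (Short $\mathbb{C}^k$): for $k\geq 2$, a domain $\Omega\subseteq\mathbb{C}^k$ is a Short $\mathbb{C}^k$ if it is the union of an increasing sequence of domains each biholomorphic to the unit ball of $\mathbb{C}^k$, its Kobayashi–Royden infinitesimal pseudometric vanishes identically, and it carries a non-constant plurisubharmonic function bounded above. *)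

theory Defs
  imports "HOL-Analysis.Analysis" "HOL-Computational_Algebra.Polynomial"
begin

text \<open>We model \<open>\<complex>\<^sup>2\<close> as \<open>complex \<times> complex\<close>; its norm is the Euclidean one,
  so \<open>ball 0 1\<close> is the unit ball of \<open>\<complex>\<^sup>2\<close>.\<close>

definition cmul :: "complex \<Rightarrow> complex \<times> complex \<Rightarrow> complex \<times> complex" where
  "cmul c p = (c * fst p, c * snd p)"

definition holo2 :: "(complex \<times> complex) set \<Rightarrow> (complex \<times> complex \<Rightarrow> complex \<times> complex) \<Rightarrow> bool" where
  "holo2 U f \<longleftrightarrow> open U \<and> (\<forall>x\<in>U. \<exists>L. (f has_derivative L) (at x) \<and>
      (\<forall>c v. L (cmul c v) = cmul c (L v)))"

definition biholomorphic :: "(complex \<times> complex) set \<Rightarrow> (complex \<times> complex) set \<Rightarrow> bool" where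
  "biholomorphic A B \<longleftrightarrow> (\<exists>f g. holo2 A f \<and> holo2 B g \<and> f ` A = B \<and> g ` B = A \<and>
      (\<forall>x\<in>A. g (f x) = x) \<and> (\<forall>y\<in>B. f (g y) = y))"

definition domain2 :: "(complex \<times> complex) set \<Rightarrow> bool" where
  "domain2 D \<longleftrightarrow> open D \<and> connected D \<and> D \<noteq> {}"

definition kobayashi_royden ::
  "(complex \<times> complex) set \<Rightarrow> complex \<times> complex \<Rightarrow> complex \<times> complex \<Rightarrow> real" where
  "kobayashi_royden \<Omega> p v = Inf {1 / r | r. r > 0 \<and> (\<exists>\<phi> :: complex \<Rightarrow> complex \<times> complex.
      (\<lambda>\<zeta>. fst (\<phi> \<zeta>)) holomorphic_on ball 0 r \<and> (\<lambda>\<zeta>. snd (\<phi> \<zeta>)) holomorphic_on ball 0 r \<and>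
      \<phi> ` ball 0 r \<subseteq> \<Omega> \<and> \<phi> 0 = p \<and>
      (deriv (\<lambda>\<zeta>. fst (\<phi> \<zeta>)) 0, deriv (\<lambda>\<zeta>. snd (\<phi> \<zeta>)) 0) = v)}"

definition usc_on :: "(complex \<times> complex) set \<Rightarrow> (complex \<times> complex \<Rightarrow> real) \<Rightarrow> bool" where
  "usc_on \<Omega> u \<longleftrightarrow> (\<forall>x\<in>\<Omega>. \<forall>t. u x < t \<longrightarrow> (\<forall>\<^sub>F y in at x within \<Omega>. u y < t))"

text \<open>Plurisubharmonic (Klimek's definition): upper semicontinuous, and for all
  \<open>a, b\<close> with \<open>{a + \<lambda> b : |\<lambda>| \<le> 1} \<subseteq> \<Omega>\<close> the sub-mean value inequality
  \<open>u(a) \<le> (1/2\<pi>) \<integral>\<^sub>0\<^sup>2\<^sup>\<pi> u(a + e^{i\<theta>} b) d\<theta>\<close> holds.  The integral of the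
  (bounded above) function is expressed via any upper bound M as
  \<open>M - (1/2\<pi>) \<integral>\<^sup>+ (M - u)\<close>, which is the usual value in \<open>[-\<infinity>,\<infinity>)\<close>.\<close>
definition psh_on :: "(complex \<times> complex) set \<Rightarrow> (complex \<times> complex \<Rightarrow> real) \<Rightarrow> bool" where
  "psh_on \<Omega> u \<longleftrightarrow> usc_on \<Omega> u \<and>
     (\<forall>a b. (\<forall>t. norm t \<le> 1 \<longrightarrow> a + cmul t b \<in> \<Omega>) \<longrightarrow>
        (\<forall>M. (\<forall>\<theta>. u (a + cmul (cis \<theta>) b) \<le> M) \<longrightarrow>
           u a \<le> M \<and>
           (\<integral>\<^sup>+ \<theta>. ennreal (M - u (a + cmul (cis \<theta>) b)) * indicator {0..2*pi} \<theta> \<partial>lborel)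
             \<le> ennreal (2 * pi) * ennreal (M - u a)))"

definition short_C2 :: "(complex \<times> complex) set \<Rightarrow> bool" where
  "short_C2 \<Omega> \<longleftrightarrow> domain2 \<Omega> \<and>
     (\<exists>D :: nat \<Rightarrow> (complex \<times> complex) set. (\<forall>n. D n \<subseteq> D (Suc n)) \<and> (\<Union>n. D n) = \<Omega> \<and>
        (\<forall>n. domain2 (D n) \<and> biholomorphic (ball 0 1) (D n))) \<and>
     (\<forall>p\<in>\<Omega>. \<forall>v. kobayashi_royden \<Omega> p v = 0) \<and>
     (\<exists>u. psh_on \<Omega> u \<and> (\<exists>C. \<forall>x\<in>\<Omega>. u x \<le> C) \<and> \<not> (\<exists>c. \<forall>x\<in>\<Omega>. u x = c))"

definition logplus :: "real \<Rightarrow> real" where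
  "logplus x = (if x \<le> 1 then 0 else ln x)"

definition henon :: "nat \<Rightarrow> complex poly \<Rightarrow> complex \<Rightarrow> complex \<times> complex \<Rightarrow> complex \<times> complex" where
  "henon d q \<delta> p = (fst p ^ d + poly q (fst p) + \<delta> * snd p, fst p)"

text \<open>\<open>henon_iter d q \<delta> n = F_n \<circ> \<dots> \<circ> F_1\<close> (maps indexed from 1).\<close>
fun henon_iter :: "nat \<Rightarrow> (nat \<Rightarrow> complex poly) \<Rightarrow> (nat \<Rightarrow> complex) \<Rightarrow> nat \<Rightarrow>
    complex \<times> complex \<Rightarrow> complex \<times> complex" where
  "henon_iter d q \<delta> 0 = id"
| "henon_iter d q \<delta> (Suc n) = henon d (q (Suc n)) (\<delta> (Suc n)) \<circ> henon_iter d q \<delta> n"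

definition green_plus :: "nat \<Rightarrow> (nat \<Rightarrow> complex poly) \<Rightarrow> (nat \<Rightarrow> complex) \<Rightarrow> complex \<times> complex \<Rightarrow> real" where
  "green_plus d q \<delta> p = lim (\<lambda>n. logplus (norm (henon_iter d q \<delta> n p)) / real d ^ n)"

end

theory Submission
  imports Defs "HOL-Complex_Analysis.Complex_Analysis" "HOL-Real_Asymp.Real_Asymp"
begin

text \<open>Let \<open>L\<^sub>n = log\<^sup>+ |F\<^sub>n \<circ> \<dots> \<circ> F\<^sub>1|\<close>.  Since \<open>L\<^sub>n\<^sub>+\<^sub>1 \<le> d L\<^sub>n + ln K\<close> with \<open>K\<close> independent of \<open>n\<close>, the functions
  \<open>a\<^sub>n = (L\<^sub>n + ln K) / d\<^sup>n\<close> decrease to the Green function \<open>G\<close>.  Hence \<open>{G < r}\<close> is the increasing union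
  of the sets \<open>{a\<^sub>n < r}\<close>, which are preimages of round balls of radius \<open>exp (r d\<^sup>n - ln K)\<close> under polynomial
  automorphisms.  As a decreasing limit of plurisubharmonic functions, \<open>G\<close> is plurisubharmonic, and it
  takes arbitrarily small positive values at preimages of a fixed escaping point.  Near a point of
  \<open>{G < r}\<close> the iterates, and by Cauchy's estimates their derivatives, are \<open>O(exp (r' d\<^sup>n))\<close>
  for some \<open>r' < r\<close>, which is negligible against the radii of these balls; so affine discs of any size
  pull back into \<open>{G < r}\<close>.\<close>

subsection \<open>Holomorphic maps of \<open>\<complex>\<^sup>2\<close>\<close>

lemma cmul_assoc: "cmul c (cmul c' p) = cmul (c * c') p"
  by (simp add: cmul_def)

lemma cmul_one [simp]: "cmul 1 p = p"
  by (simp add: cmul_def)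

lemma cmul_zero_left [simp]: "cmul 0 p = 0"
  by (simp add: cmul_def zero_prod_def)

lemma norm_cmul: "norm (cmul c p) = norm c * norm p"
proof -
  have "norm (cmul c p) = sqrt ((norm c)\<^sup>2 * ((norm (fst p))\<^sup>2 + (norm (snd p))\<^sup>2))"
    by (simp add: cmul_def norm_prod_def norm_mult power_mult_distrib algebra_simps)
  then show ?thesis
    by (simp add: real_sqrt_mult norm_prod_def)
qed

lemma norm_fst_snd_le: "norm (fst p) \<le> norm p" "norm (snd p) \<le> norm p"
  using norm_fst_le[of "fst p" "snd p"] norm_snd_le[of "snd p" "fst p"] by simp_all

lemma holo2_subset: "holo2 A f \<Longrightarrow> open B \<Longrightarrow> B \<subseteq> A \<Longrightarrow> holo2 B f"
  by (auto simp: holo2_def)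

lemma holo2_compose:
  assumes "holo2 A f" "holo2 B g" "f ` A \<subseteq> B"
  shows "holo2 A (g \<circ> f)"
  unfolding holo2_def
proof (intro conjI ballI)
  show "open A" using assms(1) by (simp add: holo2_def)
  fix x assume "x \<in> A"
  obtain L where L: "(f has_derivative L) (at x)" "\<And>c v. L (cmul c v) = cmul c (L v)"
    using assms(1) \<open>x \<in> A\<close> by (auto simp: holo2_def)
  obtain K where K: "(g has_derivative K) (at (f x))" "\<And>c v. K (cmul c v) = cmul c (K v)"
    using assms(2,3) \<open>x \<in> A\<close> unfolding holo2_def by blast
  show "\<exists>L. (g \<circ> f has_derivative L) (at x) \<and> (\<forall>c v. L (cmul c v) = cmul c (L v))"
    using diff_chain_at[OF L(1) K(1)] L(2) K(2) by (intro exI[of _ "K \<circ> L"]) auto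
qed

lemma holo2_continuous_on: "holo2 A f \<Longrightarrow> continuous_on A f"
  unfolding holo2_def
  by (meson continuous_at_imp_continuous_on has_derivative_continuous)

lemma holo2_id: "holo2 UNIV id"
  unfolding holo2_def by (auto intro!: exI[of _ id] simp: id_def)

lemma holo2_cmul: "holo2 UNIV (cmul c)"
  unfolding holo2_def
proof (intro conjI ballI)
  fix x
  have "(cmul c has_derivative cmul c) (at x)"
    unfolding cmul_def by (auto intro!: derivative_eq_intros)
  then show "\<exists>L. (cmul c has_derivative L) (at x) \<and> (\<forall>c v. L (cmul c v) = cmul c (L v))"
    by (intro exI[of _ "cmul c"]) (auto simp: cmul_assoc mult.commute)
qed simp

lemma cmul_line_has_derivative:
  "((\<lambda>t. p + cmul t v) has_derivative (\<lambda>t. cmul t v)) (at x within S)"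
  unfolding cmul_def by (auto intro!: derivative_eq_intros)

text \<open>Complex homogeneity of \<open>L\<close> makes the real derivative along a complex line
  multiplication by the number \<open>fst (L v)\<close> or \<open>snd (L v)\<close>, so one-variable
  complex analysis applies to each coordinate.\<close>

lemma holo2_line:
  assumes "(f has_derivative L) (at (p + cmul t v))" "\<And>c v. L (cmul c v) = cmul c (L v)"
  shows "((\<lambda>t. fst (f (p + cmul t v))) has_field_derivative fst (L v)) (at t)"
    and "((\<lambda>t. snd (f (p + cmul t v))) has_field_derivative snd (L v)) (at t)"
proof -
  have D: "((\<lambda>t. f (p + cmul t v)) has_derivative (\<lambda>s. cmul s (L v))) (at t)"
    using diff_chain_at[OF cmul_line_has_derivative assms(1)] assms(2)
    by (simp add: o_def)
  show "((\<lambda>t. fst (f (p + cmul t v))) has_field_derivative fst (L v)) (at t)"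
    using has_derivative_fst[OF D]
    by (simp add: has_field_derivative_def cmul_def mult.commute[of _ "fst (L v)"])
  show "((\<lambda>t. snd (f (p + cmul t v))) has_field_derivative snd (L v)) (at t)"
    using has_derivative_snd[OF D]
    by (simp add: has_field_derivative_def cmul_def mult.commute[of _ "snd (L v)"])
qed

lemma holo2_line_holomorphic:
  assumes "holo2 UNIV f"
  shows "(\<lambda>t. fst (f (p + cmul t v))) holomorphic_on S" "(\<lambda>t. snd (f (p + cmul t v))) holomorphic_on S"
proof -
  have "(\<lambda>t. fst (f (p + cmul t v))) field_differentiable at t \<and>
      (\<lambda>t. snd (f (p + cmul t v))) field_differentiable at t" for t
  proof -
    obtain L where "(f has_derivative L) (at (p + cmul t v))" "\<And>c v. L (cmul c v) = cmul c (L v)"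
      using assms unfolding holo2_def by blast
    from holo2_line[OF this] show ?thesis unfolding field_differentiable_def by blast
  qed
  then show "(\<lambda>t. fst (f (p + cmul t v))) holomorphic_on S"
    "(\<lambda>t. snd (f (p + cmul t v))) holomorphic_on S"
    unfolding holomorphic_on_def by (blast intro: field_differentiable_at_within)+
qed

subsection \<open>The sub-mean value inequality for \<open>log\<^sup>+\<close> of a norm\<close>

text \<open>Uniform continuity makes equidistant Riemann sums converge to the integral whatever the
  tags are. Hence the common offset \<open>s\<close> may depend on \<open>N\<close>.\<close>

lemma riemann_sum_le_integral:
  fixes \<phi> :: "real \<Rightarrow> real" and c :: real
  assumes cont: "continuous_on {0..2*pi} \<phi>"
    and le: "\<And>N::nat. N > 0 \<Longrightarrow> \<exists>s\<in>{0..2*pi/N}. N * c \<le> (\<Sum>k<N. \<phi> (s + 2*pi*real k/N))"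
  shows "2 * pi * c \<le> integral {0..2*pi} \<phi>"
proof (rule field_le_epsilon)
  fix e :: real assume "e > 0"
  define e' where "e' = e / (2*pi)"
  have "e' > 0" using \<open>e > 0\<close> by (simp add: e'_def)
  have "uniformly_continuous_on {0..2*pi} \<phi>"
    using cont by (intro compact_uniformly_continuous) auto
  then obtain dd where dd: "dd > 0"
    "\<And>x y. x \<in> {0..2*pi} \<Longrightarrow> y \<in> {0..2*pi} \<Longrightarrow> dist y x < dd \<Longrightarrow> dist (\<phi> y) (\<phi> x) < e'"
    unfolding uniformly_continuous_on_def using \<open>e' > 0\<close> by metis
  obtain N :: nat where N: "N > 2*pi/dd" using reals_Archimedean2 by blast
  have "N > 0" using N dd(1) by (metis divide_nonneg_pos le_less_trans of_nat_0_less_iff pi_ge_zero zero_le_mult_iff zero_le_numeral)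
  define h where "h = 2*pi/N"
  have h: "h > 0" "h < dd" "N * h = 2*pi"
    using N dd(1) \<open>N > 0\<close> by (auto simp: h_def field_simps)
  obtain s where s: "0 \<le> s" "s \<le> h" and sN: "N * c \<le> (\<Sum>k<N. \<phi> (s + 2*pi*real k/N))"
    using le[OF \<open>N > 0\<close>] by (auto simp: h_def)
  \<comment> \<open>The tag \<open>s + m*h\<close> lies in the piece from \<open>m*h\<close> to
    \<open>Suc m * h\<close>, whose length is below \<open>dd\<close>; each piece therefore costs an
    error of at most \<open>h * e'\<close>.\<close>
  have m: "h * (\<Sum>k<m. \<phi> (s + 2*pi*real k/N)) \<le> integral {0..m*h} \<phi> + m * h * e'" if "m \<le> N" for m
    using that
  proof (induction m)
    case (Suc m)
    have mh: "Suc m * h \<le> 2*pi" using Suc.prems h(1) unfolding h(3)[symmetric]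
      by (intro mult_right_mono) auto
    have "0 \<le> real m * h" using h(1) by simp
    have co: "continuous_on {0..Suc m * h} \<phi>" "continuous_on {m*h..Suc m * h} \<phi>"
      using mh \<open>0 \<le> real m * h\<close> by (auto intro!: continuous_on_subset[OF cont])
    have split: "integral {0..Suc m * h} \<phi> = integral {0..m*h} \<phi> + integral {m*h..Suc m * h} \<phi>"
      using co(1) h(1)
      by (intro Henstock_Kurzweil_Integration.integral_combine[symmetric] integrable_continuous_interval)
        (auto simp: algebra_simps)
    have tag: "s + 2*pi*m/N = s + m*h" by (simp add: h_def)
    have "integral {m*h..Suc m*h} (\<lambda>x. \<phi> (s + m*h) - e') \<le> integral {m*h..Suc m * h} \<phi>"
    proof (rule integral_le)
      show "\<phi> integrable_on {m*h..Suc m * h}"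
        using co(2) by (rule integrable_continuous_interval)
      fix x assume x: "x \<in> {m*h..Suc m * h}"
      have "dist (\<phi> (s + m*h)) (\<phi> x) < e'"
      proof (rule dd(2))
        have "0 \<le> x" using \<open>0 \<le> real m * h\<close> x by (meson atLeastAtMost_iff order_trans)
        then show "x \<in> {0..2*pi}" using x mh by auto
        show "s + m*h \<in> {0..2*pi}" using s mh h(1) by (auto simp: algebra_simps)
        show "dist (s + m*h) x < dd" using s x h(2) by (auto simp: dist_real_def algebra_simps)
      qed
      then show "\<phi> (s + m*h) - e' \<le> \<phi> x" by (simp add: dist_real_def)
    qed auto
    then have J: "h * (\<phi> (s + m*h) - e') \<le> integral {m*h..Suc m * h} \<phi>"
      using h(1) by (simp add: algebra_simps)
    have A: "h * (\<Sum>k<m. \<phi> (s + 2*pi*real k/N)) \<le> integral {0..m*h} \<phi> + m * h * e'"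
      using Suc by simp
    have step: "h * (A + y) \<le> I + J + Suc m * h * e'"
      if "h * (y - e') \<le> J" "h * A \<le> I + m * h * e'" for A y I J
      using that by (simp add: algebra_simps)
    show ?case
      unfolding split sum.lessThan_Suc tag by (rule step[OF J A])
  qed simp
  have "2*pi*c = h * (N * c)" unfolding h(3)[symmetric] by (simp add: mult_ac)
  also have "\<dots> \<le> h * (\<Sum>k<N. \<phi> (s + 2*pi*real k/N))"
    using sN h(1) by (intro mult_left_mono) auto
  also have "\<dots> \<le> integral {0..N*h} \<phi> + N * h * e'"
    by (rule m) simp
  also have "\<dots> = integral {0..2*pi} \<phi> + e"
    unfolding h(3) by (simp add: e'_def)
  finally show "2*pi*c \<le> integral {0..2*pi} \<phi> + e" .
qed

text \<open>The function \<open>t \<mapsto> \<Prod>\<^sub>k h(\<omega>\<^sup>k t)\<close>, with \<open>\<omega>\<close> a primitive \<open>N\<close>-th root of unity, is invariant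
  under \<open>t \<mapsto> \<omega> t\<close>, so it attains its maximum over the circle on every arc of length \<open>2\<pi>/N\<close>.\<close>

lemma prod_over_roots_of_unity_le:
  fixes h :: "complex \<Rightarrow> complex" and N :: nat
  assumes h: "h holomorphic_on UNIV" and N: "N > 0"
  shows "\<exists>s\<in>{0..2*pi/N}. norm (h 0) ^ N \<le> (\<Prod>k<N. norm (h (cis (s + 2*pi*real k/N))))"
proof -
  define \<omega> where "\<omega> = cis (2*pi/N)"
  define H where "H = (\<lambda>t. \<Prod>k<N. h (\<omega>^k * t))"
  have pow: "\<omega>^k = cis (2*pi*real k/N)" for k
    unfolding \<omega>_def Complex.DeMoivre by (simp add: mult_ac)
  have "H holomorphic_on cball 0 1"
    unfolding H_def
    by (intro holomorphic_on_prod holomorphic_on_compose_gen[OF _ h, unfolded o_def] holomorphic_intros) auto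
  \<comment> \<open>Since \<open>\<omega>^N = 1\<close>, replacing \<open>t\<close> by
    \<open>\<omega> * t\<close> only permutes the factors cyclically.\<close>
  have rot: "H (\<omega> * t) = H t" for t
  proof -
    obtain m where m: "N = Suc m" using N gr0_conv_Suc by auto
    have "\<omega>^N = 1" using N by (simp add: pow)
    then have *: "\<omega>^m * (\<omega> * t) = t" unfolding m by (simp add: algebra_simps)
    have "H (\<omega> * t) = (\<Prod>k<m. h (\<omega>^k * (\<omega> * t))) * h (\<omega>^m * (\<omega> * t))"
      by (simp add: H_def m)
    also have "\<dots> = h (\<omega>^0 * t) * (\<Prod>k<m. h (\<omega>^Suc k * t))"
      by (simp only: *) (simp add: algebra_simps)
    also have "\<dots> = H t"
      unfolding H_def m prod.lessThan_Suc_shift by simp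
    finally show ?thesis .
  qed
  have rotk: "H (\<omega>^k * t) = H t" for k t
    by (induction k arbitrary: t) (simp_all add: rot mult.assoc)
  obtain t where t: "norm t = 1" "\<And>z. norm z = 1 \<Longrightarrow> norm (H z) \<le> norm (H t)"
  proof -
    have "continuous_on (sphere 0 1) (\<lambda>z. norm (H z))"
      using \<open>H holomorphic_on cball 0 1\<close>
      by (intro continuous_on_norm holomorphic_on_imp_continuous_on) (auto elim: holomorphic_on_subset)
    from continuous_attains_sup[OF compact_sphere _ this]
    obtain t where "t \<in> sphere 0 1" "\<forall>z\<in>sphere 0 1. norm (H z) \<le> norm (H t)" by auto
    then show ?thesis using that by (auto simp: dist_norm)
  qed
  have "norm (H 0) \<le> norm (H t)"
  proof (rule maximum_modulus_frontier[where S = "cball 0 1" and f = H])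
    show "H holomorphic_on interior (cball 0 1)"
      using \<open>H holomorphic_on cball 0 1\<close> by (rule holomorphic_on_subset) (rule interior_subset)
    show "continuous_on (closure (cball 0 1)) H"
      using \<open>H holomorphic_on cball 0 1\<close> by (simp add: holomorphic_on_imp_continuous_on)
    show "norm (H z) \<le> norm (H t)" if "z \<in> frontier (cball 0 1)" for z
      using that t(2) by simp
  qed auto
  have "t \<noteq> 0" using t(1) by auto
  \<comment> \<open>The maximum point is turned back by \<open>j\<close> steps of
    \<open>2*pi/N\<close> into the first arc; a nonnegative angle is chosen so that
    \<open>nat\<close> of the floor loses nothing.\<close>
  obtain \<theta> where \<theta>: "0 \<le> \<theta>" "t = cis \<theta>"
  proof
    show "0 \<le> Arg t + 2*pi" using Arg_bounded[of t] by linarith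
    show "t = cis (Arg t + 2*pi)" using \<open>t \<noteq> 0\<close> t(1) cis_Arg[of t] by (simp add: sgn_eq flip: cis_mult)
  qed
  define j where "j = nat \<lfloor>\<theta> / (2*pi/N)\<rfloor>"
  define s where "s = \<theta> - j * (2*pi/N)"
  have j: "real j \<le> \<theta> / (2*pi/N)" "\<theta> / (2*pi/N) < real j + 1"
    using \<theta>(1) unfolding j_def by (simp_all add: of_nat_nat)
  have hp: "2*pi/N > 0" using N by simp
  have s: "s \<in> {0..2*pi/N}"
    using j unfolding s_def pos_le_divide_eq[OF hp] pos_divide_less_eq[OF hp] distrib_right
    by simp
  have "\<omega>^j * cis s = t"
    unfolding pow \<theta>(2) cis_mult s_def by (simp add: mult.commute)
  then have "H t = H (cis s)" using rotk by metis
  moreover have "norm (H (cis s)) = (\<Prod>k<N. norm (h (cis (s + 2*pi*real k/N))))"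
    unfolding H_def pow cis_mult by (simp add: prod_norm add.commute)
  moreover have "norm (H 0) = norm (h 0) ^ N"
    unfolding H_def by (simp add: norm_power)
  ultimately show ?thesis
    using \<open>norm (H 0) \<le> norm (H t)\<close> s by auto
qed

lemma logplus_eq: "logplus x = ln (max 1 x)"
  by (auto simp: logplus_def max_def)

lemma logplus_nonneg: "logplus x \<ge> 0"
  by (auto simp: logplus_def)

lemma continuous_on_logplus [continuous_intros]:
  "continuous_on A f \<Longrightarrow> continuous_on A (\<lambda>x. logplus (f x))"
  unfolding logplus_eq by (intro continuous_intros) auto

text \<open>Projecting \<open>(f, g)\<close> onto the direction of its value at 0 gives a scalar
  holomorphic function with the same modulus at 0 and no larger modulus elsewhere. The product over
  roots of unity then bounds Riemann sums from below, so zeros of that function, where its logarithm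
  is singular, do no harm.\<close>

lemma logplus_norm_submean:
  fixes f g :: "complex \<Rightarrow> complex"
  assumes f: "f holomorphic_on UNIV" and g: "g holomorphic_on UNIV"
  shows "2 * pi * logplus (norm (f 0, g 0)) \<le> integral {0..2*pi} (\<lambda>\<theta>. logplus (norm (f (cis \<theta>), g (cis \<theta>))))"
proof (rule riemann_sum_le_integral)
  show "continuous_on {0..2*pi} (\<lambda>\<theta>. logplus (norm (f (cis \<theta>), g (cis \<theta>))))"
    by (intro continuous_intros continuous_on_compose2[OF holomorphic_on_imp_continuous_on[OF f]]
      continuous_on_compose2[OF holomorphic_on_imp_continuous_on[OF g]]) auto
  fix N :: nat assume N: "N > 0"
  show "\<exists>s\<in>{0..2*pi/N}. N * logplus (norm (f 0, g 0))
      \<le> (\<Sum>k<N. logplus (norm (f (cis (s + 2*pi*real k/N)), g (cis (s + 2*pi*real k/N)))))"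
  proof (cases "norm (f 0, g 0) \<le> 1")
    case True
    then have "logplus (norm (f 0, g 0)) = 0" by (simp add: logplus_def)
    then show ?thesis using N by (intro bexI[of _ 0]) (auto intro!: sum_nonneg logplus_nonneg)
  next
    case False
    define n0 where "n0 = norm (f 0, g 0)"
    have n0: "n0 > 1" using False by (simp add: n0_def)
    have n0sq: "(norm (f 0))\<^sup>2 + (norm (g 0))\<^sup>2 = n0\<^sup>2"
      by (simp add: n0_def norm_prod_def)
    \<comment> \<open>The Hermitian product of \<open>(f t, g t)\<close> with the unit vector
      \<open>(f 0, g 0) / n0\<close>; Cauchy-Schwarz bounds it by the norm of
      \<open>(f t, g t)\<close>.\<close>
    define h where "h = (\<lambda>t. (cnj (f 0) * f t + cnj (g 0) * g t) / of_real n0)"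
    have "h holomorphic_on UNIV"
      unfolding h_def using f g n0 by (intro holomorphic_intros) auto
    from prod_over_roots_of_unity_le[OF this N]
    obtain s where s: "s \<in> {0..2*pi/N}"
      and le: "norm (h 0) ^ N \<le> (\<Prod>k<N. norm (h (cis (s + 2*pi*real k/N))))" by blast
    have "h 0 = of_real n0"
    proof -
      have "cnj (f 0) * f 0 + cnj (g 0) * g 0 = of_real (n0\<^sup>2)"
        unfolding n0sq[symmetric] by (simp add: mult.commute flip: complex_norm_square)
      then show ?thesis using n0 by (simp add: h_def power2_eq_square)
    qed
    then have h0: "norm (h 0) = n0" using n0 by simp
    have hle: "norm (h t) \<le> max 1 (norm (f t, g t))" for t
    proof -
      have "norm (cnj (f 0) * f t + cnj (g 0) * g t) \<le> norm (f 0) * norm (f t) + norm (g 0) * norm (g t)"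
        by (metis complex_mod_cnj norm_mult norm_triangle_ineq)
      also have "\<dots> = (norm (f 0), norm (g 0)) \<bullet> (norm (f t), norm (g t))"
        by (simp add: inner_prod_def)
      also have "\<dots> \<le> norm (norm (f 0), norm (g 0)) * norm (norm (f t), norm (g t))"
        by (rule norm_cauchy_schwarz)
      also have "\<dots> = n0 * norm (f t, g t)"
        by (simp add: n0_def norm_prod_def)
      finally have "norm (h t) \<le> norm (f t, g t)" using n0 by (simp add: h_def norm_divide field_simps)
      then show ?thesis by simp
    qed
    have "N * logplus n0 = ln (n0 ^ N)"
      using n0 by (simp add: logplus_def ln_realpow)
    also have "\<dots> \<le> ln (\<Prod>k<N. max 1 (norm (f (cis (s + 2*pi*real k/N)), g (cis (s + 2*pi*real k/N)))))"
    proof -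
      have "n0 ^ N \<le> (\<Prod>k<N. max 1 (norm (f (cis (s + 2*pi*real k/N)), g (cis (s + 2*pi*real k/N)))))"
        using le unfolding h0 by (rule order_trans) (intro prod_mono conjI hle norm_ge_zero)
      then show ?thesis using n0 by (subst ln_le_cancel_iff) (auto intro: less_le_trans[rotated])
    qed
    also have "\<dots> = (\<Sum>k<N. logplus (norm (f (cis (s + 2*pi*real k/N)), g (cis (s + 2*pi*real k/N)))))"
      unfolding logplus_eq by (subst ln_prod) auto
    finally show ?thesis using s by (auto simp: n0_def)
  qed
qed


subsection \<open>The Green function of a bounded sequence of Henon maps\<close>

definition henon_inv :: "nat \<Rightarrow> complex poly \<Rightarrow> complex \<Rightarrow> complex \<times> complex \<Rightarrow> complex \<times> complex" where
  "henon_inv d q \<delta> p = (snd p, (fst p - snd p ^ d - poly q (snd p)) / \<delta>)"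

lemma henon_inv: "\<delta> \<noteq> 0 \<Longrightarrow> henon_inv d q \<delta> (henon d q \<delta> p) = p"
  by (simp add: henon_inv_def henon_def)

lemma henon_henon_inv: "\<delta> \<noteq> 0 \<Longrightarrow> henon d q \<delta> (henon_inv d q \<delta> p) = p"
  by (simp add: henon_inv_def henon_def)

text \<open>Absorbs the leading power into one polynomial, so that a single use of
  \<open>poly_DERIV\<close> differentiates the first coordinate.\<close>

lemma poly_monom_add: "poly (monom 1 d + q) z = z ^ d + poly q (z :: complex)"
  by (simp add: poly_monom)

lemma holo2_henon: "holo2 UNIV (henon d q \<delta>)"
  unfolding holo2_def
proof (intro conjI ballI exI)
  fix p :: "complex \<times> complex"
  let ?Q = "monom 1 d + q"
  have "((\<lambda>x. poly ?Q (fst x)) has_derivative (\<lambda>v. poly (pderiv ?Q) (fst p) * fst v)) (at p)"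
    by (rule has_derivative_compose[OF has_derivative_fst[OF has_derivative_ident]
        poly_DERIV[THEN has_field_derivative_imp_has_derivative]])
  then show "(henon d q \<delta> has_derivative (\<lambda>v. (poly (pderiv ?Q) (fst p) * fst v + \<delta> * snd v, fst v))) (at p)"
    unfolding henon_def poly_monom_add[symmetric]
    by (intro has_derivative_Pair has_derivative_add
        has_derivative_mult_right has_derivative_fst has_derivative_snd has_derivative_ident)
qed (auto simp: cmul_def algebra_simps)

lemma holo2_henon_inv: "holo2 UNIV (henon_inv d q \<delta>)"
  unfolding holo2_def
proof (intro conjI ballI exI)
  fix p :: "complex \<times> complex"
  let ?Q = "monom 1 d + q"
  have "henon_inv d q \<delta> = (\<lambda>p. (snd p, inverse \<delta> * (fst p - poly ?Q (snd p))))"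
    by (auto simp: henon_inv_def poly_monom fun_eq_iff field_simps)
  moreover have "((\<lambda>x. poly ?Q (snd x)) has_derivative (\<lambda>v. poly (pderiv ?Q) (snd p) * snd v)) (at p)"
    by (rule has_derivative_compose[OF has_derivative_snd[OF has_derivative_ident]
        poly_DERIV[THEN has_field_derivative_imp_has_derivative]])
  ultimately show "(henon_inv d q \<delta> has_derivative
      (\<lambda>v. (snd v, inverse \<delta> * (fst v - poly (pderiv ?Q) (snd p) * snd v)))) (at p)"
    by (simp only:) (intro has_derivative_Pair has_derivative_diff
        has_derivative_mult_right has_derivative_fst has_derivative_snd has_derivative_ident)
qed (auto simp: cmul_def algebra_simps)

fun henon_iter_inv :: "nat \<Rightarrow> (nat \<Rightarrow> complex poly) \<Rightarrow> (nat \<Rightarrow> complex) \<Rightarrow> nat \<Rightarrow>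
    complex \<times> complex \<Rightarrow> complex \<times> complex" where
  "henon_iter_inv d q \<delta> 0 = id"
| "henon_iter_inv d q \<delta> (Suc n) = henon_iter_inv d q \<delta> n \<circ> henon_inv d (q (Suc n)) (\<delta> (Suc n))"

lemma holo2_henon_iter: "holo2 UNIV (henon_iter d q \<delta> n)"
proof (induction n)
  case (Suc n)
  show ?case unfolding henon_iter.simps by (rule holo2_compose[OF Suc holo2_henon]) simp
qed (simp add: holo2_id[unfolded id_def] id_def)

lemma holo2_henon_iter_inv: "holo2 UNIV (henon_iter_inv d q \<delta> n)"
proof (induction n)
  case (Suc n)
  show ?case unfolding henon_iter_inv.simps by (rule holo2_compose[OF holo2_henon_inv Suc]) simp
qed (simp add: holo2_id[unfolded id_def] id_def)

text \<open>Fixing one uniform bound \<open>M\<close> lets the constants \<open>K\<close> and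
  \<open>R\<close> below depend on \<open>d\<close> and \<open>M\<close> only.\<close>

locale bounded_henon_sequence =
  fixes d :: nat and q :: "nat \<Rightarrow> complex poly" and \<delta> :: "nat \<Rightarrow> complex" and M :: real
  assumes d2: "d \<ge> 2"
    and deg: "n \<ge> 1 \<Longrightarrow> degree (q n) \<le> d - 1"
    and nz: "n \<ge> 1 \<Longrightarrow> \<delta> n \<noteq> 0"
    and \<delta>_le: "n \<ge> 1 \<Longrightarrow> norm (\<delta> n) \<le> M"
    and coeff_le: "n \<ge> 1 \<Longrightarrow> norm (coeff (q n) i) \<le> M"
begin

abbreviation "F \<equiv> henon_iter d q \<delta>"
abbreviation "F_inv \<equiv> henon_iter_inv d q \<delta>"
abbreviation "G \<equiv> green_plus d q \<delta>"

lemma F_inv_F: "F_inv n (F n p) = p"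
  by (induction n) (simp_all add: henon_inv nz)

lemma F_F_inv: "F n (F_inv n p) = p"
  by (induction n arbitrary: p) (simp_all add: henon_henon_inv nz)

lemma M_nonneg: "M \<ge> 0"
  using \<delta>_le[of 1] norm_ge_zero[of "\<delta> 1"] by linarith

text \<open>There are at most \<open>d\<close> coefficients, each of modulus at most
  \<open>M\<close>, and \<open>1 \<le> x\<close> lets \<open>x ^ (d - 1)\<close> dominate every
  power that occurs.\<close>

lemma norm_poly_le:
  assumes "n \<ge> 1" "norm z \<le> x" "1 \<le> x"
  shows "norm (poly (q n) z) \<le> d * M * x ^ (d - 1)"
proof -
  have "norm (poly (q n) z) \<le> (\<Sum>i\<le>degree (q n). norm (coeff (q n) i * z ^ i))"
    unfolding poly_altdef by (rule norm_sum)
  also have "\<dots> \<le> (\<Sum>i\<le>degree (q n). M * x ^ (d - 1))"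
  proof (rule sum_mono)
    fix i assume "i \<in> {..degree (q n)}"
    then have "i \<le> d - 1" using deg[OF assms(1)] by simp
    have "norm z ^ i \<le> x ^ i" using assms by (intro power_mono) auto
    also have "\<dots> \<le> x ^ (d - 1)" using assms \<open>i \<le> d - 1\<close> by (intro power_increasing) auto
    finally show "norm (coeff (q n) i * z ^ i) \<le> M * x ^ (d - 1)"
      unfolding norm_mult norm_power using coeff_le[OF assms(1)] M_nonneg
      by (intro mult_mono) auto
  qed
  also have "\<dots> = (degree (q n) + 1) * (M * x ^ (d - 1))" by simp
  also have "\<dots> \<le> d * (M * x ^ (d - 1))"
    using deg[OF assms(1)] d2 M_nonneg assms by (intro mult_right_mono) auto
  finally show ?thesis by (simp add: mult.assoc)
qed

text \<open>The first coordinate of a Henon map contributes \<open>1 + d * M + M\<close> (leading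
  term, \<open>q n\<close>, \<open>\<delta> n\<close>), the second contributes 1.\<close>

definition K :: real where "K = 2 + (d + 1) * M"

lemma K_ge: "K \<ge> 2"
  using M_nonneg by (simp add: K_def)

lemma norm_henon_le:
  assumes "n \<ge> 1"
  shows "max 1 (norm (henon d (q n) (\<delta> n) p)) \<le> K * max 1 (norm p) ^ d"
proof -
  define x where "x = max 1 (norm p)"
  have x: "1 \<le> x" "norm (fst p) \<le> x" "norm (snd p) \<le> x"
    using norm_fst_snd_le[of p] by (auto simp: x_def)
  have xd: "x \<le> x ^ d" "x ^ (d - 1) \<le> x ^ d" "1 \<le> x ^ d"
    using x(1) d2 by (auto intro: self_le_power power_increasing one_le_power)
  have "norm (fst p ^ d + poly (q n) (fst p) + \<delta> n * snd p)
      \<le> norm (fst p) ^ d + norm (poly (q n) (fst p)) + norm (\<delta> n) * norm (snd p)"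
    by (metis (no_types) add_mono norm_mult norm_power norm_triangle_ineq norm_triangle_le order_refl)
  also have "\<dots> \<le> x ^ d + d * M * x ^ (d - 1) + M * x"
    using x norm_poly_le[OF assms x(2,1)] \<delta>_le[OF assms] M_nonneg
    by (intro add_mono mult_mono power_mono) auto
  also have "\<dots> \<le> x ^ d + d * M * x ^ d + M * x ^ d"
    using xd M_nonneg by (intro add_mono mult_left_mono) auto
  finally have 1: "norm (fst p ^ d + poly (q n) (fst p) + \<delta> n * snd p) \<le> (K - 1) * x ^ d"
    by (simp add: K_def algebra_simps)
  have "norm (henon d (q n) (\<delta> n) p) \<le> norm (fst p ^ d + poly (q n) (fst p) + \<delta> n * snd p) + norm (fst p)"
    unfolding henon_def by (rule norm_Pair_le)
  also have "\<dots> \<le> (K - 1) * x ^ d + x ^ d"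
    using 1 x xd by linarith
  finally have "norm (henon d (q n) (\<delta> n) p) \<le> K * x ^ d" by (simp add: algebra_simps)
  moreover have "1 \<le> K * x ^ d" using K_ge xd(3) mult_mono[of 1 K 1 "x ^ d"] by simp
  ultimately show ?thesis by (simp add: x_def)
qed

text \<open>A correction \<open>c\<close> in place of \<open>ln K\<close> makes the sequence
  decrease as soon as \<open>ln K \<le> (d - 1) * c\<close>; \<open>c = ln K\<close> does so for
  every \<open>d \<ge> 2\<close>.\<close>

definition a :: "nat \<Rightarrow> complex \<times> complex \<Rightarrow> real" where
  "a n p = (logplus (norm (F n p)) + ln K) / real d ^ n"

lemma logplus_norm_henon_le:
  assumes "n \<ge> 1"
  shows "logplus (norm (henon d (q n) (\<delta> n) p)) \<le> d * logplus (norm p) + ln K"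
proof -
  have "logplus (norm (henon d (q n) (\<delta> n) p)) \<le> ln (K * max 1 (norm p) ^ d)"
    unfolding logplus_eq using norm_henon_le[OF assms, of p] by (intro ln_mono) auto
  also have "\<dots> = ln K + d * logplus (norm p)"
    unfolding logplus_eq using K_ge by (subst ln_mult) (auto simp: ln_realpow max_def)
  finally show ?thesis by simp
qed

lemma a_Suc_le: "a (Suc n) p \<le> a n p"
proof -
  have "logplus (norm (F (Suc n) p)) + ln K \<le> d * logplus (norm (F n p)) + 2 * ln K"
    using logplus_norm_henon_le[of "Suc n" "F n p"] by simp
  also have "\<dots> \<le> d * (logplus (norm (F n p)) + ln K)"
    using d2 K_ge mult_right_mono[of 2 "real d" "ln K"] by (simp add: algebra_simps)
  finally have "a (Suc n) p \<le> d * (logplus (norm (F n p)) + ln K) / real d ^ Suc n"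
    unfolding a_def by (intro divide_right_mono) auto
  then show ?thesis using d2 by (simp add: a_def)
qed

lemma a_decseq: "decseq (\<lambda>n. a n p)"
  by (rule decseq_SucI) (rule a_Suc_le)

lemma a_nonneg: "a n p \<ge> 0"
  using K_ge by (simp add: a_def logplus_nonneg)

text \<open>A decreasing sequence bounded below converges, and the correction
  \<open>ln K / d ^ n\<close> tends to 0. This also shows that the limit defining
  \<open>green_plus\<close> exists, so that \<open>lim\<close> denotes it.\<close>

lemma a_tendsto: "(\<lambda>n. a n p) \<longlonglongrightarrow> G p"
  and G_le_a: "G p \<le> a n p"
proof -
  obtain L where L: "(\<lambda>n. a n p) \<longlonglongrightarrow> L" "\<forall>i. L \<le> a i p"
    using decseq_convergent[OF a_decseq, of 0 p] a_nonneg by metis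
  have "(\<lambda>n. ln K / real d ^ n) \<longlonglongrightarrow> 0"
    using d2 by real_asymp
  from tendsto_diff[OF L(1) this]
  have "(\<lambda>n. logplus (norm (F n p)) / real d ^ n) \<longlonglongrightarrow> L"
    by (simp add: a_def add_divide_distrib)
  then have "G p = L" unfolding green_plus_def by (rule limI)
  then show "(\<lambda>n. a n p) \<longlonglongrightarrow> G p" "G p \<le> a n p" using L by auto
qed

lemma G_less_iff: "G p < r \<longleftrightarrow> (\<exists>n. a n p < r)"
proof
  assume "G p < r"
  then show "\<exists>n. a n p < r"
    using order_tendstoD(2)[OF a_tendsto] eventually_happens' sequentially_bot by blast
qed (meson G_le_a le_less_trans)

text \<open>The assumption makes the radius on the right exceed 1, so the truncation in
  \<open>logplus\<close> has no effect on the comparison.\<close>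

lemma a_less_iff:
  assumes "r * real d ^ n > ln K"
  shows "a n p < r \<longleftrightarrow> norm (F n p) < exp (r * real d ^ n - ln K)"
proof -
  have "a n p < r \<longleftrightarrow> logplus (norm (F n p)) < r * real d ^ n - ln K"
    using d2 by (simp add: a_def divide_less_eq) linarith
  also have "\<dots> \<longleftrightarrow> max 1 (norm (F n p)) < exp (r * real d ^ n - ln K)"
    unfolding logplus_eq by (subst exp_less_cancel_iff[symmetric]) simp
  finally show ?thesis using assms by auto
qed

lemma continuous_on_a: "continuous_on S (a n)"
proof -
  have "continuous_on S (F n)"
    using holo2_continuous_on[OF holo2_henon_iter] continuous_on_subset by blast
  then show ?thesis unfolding a_def using d2 by (intro continuous_intros) auto
qed

lemma eventually_pow_gt:
  assumes "r > 0"
  shows "\<forall>\<^sub>F n in sequentially. r * real d ^ n > c"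
proof -
  have "filterlim (\<lambda>n. r * real d ^ n) at_top sequentially"
    using d2 assms by real_asymp
  then show ?thesis by (simp add: filterlim_at_top_dense)
qed

subsection \<open>Sublevel sets as increasing unions of balls\<close>

lemma biholomorphic_sublevel:
  assumes "r * real d ^ n > ln K"
  shows "biholomorphic (ball 0 1) {p. a n p < r}" "domain2 {p. a n p < r}"
proof -
  define \<rho> where "\<rho> = exp (r * real d ^ n - ln K)"
  have \<rho>: "\<rho> > 0" by (simp add: \<rho>_def)
  have D: "{p. a n p < r} = {p. norm (F n p) < \<rho>}" (is "?D = _")
    using a_less_iff[OF assms] by (simp add: \<rho>_def)
  have "open ?D"
    by (rule open_Collect_less) (auto intro: continuous_on_a)
  \<comment> \<open>The sublevel set is the preimage of the ball of radius \<open>\<rho>\<close>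
    under the automorphism \<open>F n\<close>; dilation by \<open>\<rho>\<close> normalizes that
    ball.\<close>
  define f where "f = F_inv n \<circ> cmul (of_real \<rho>)"
  define g where "g = cmul (of_real (1 / \<rho>)) \<circ> F n"
  have fg: "f (g x) = x" and gf: "g (f x) = x" for x
    using \<rho> by (simp_all add: f_def g_def cmul_assoc F_inv_F F_F_inv)
  have f: "holo2 UNIV f" unfolding f_def by (rule holo2_compose[OF holo2_cmul holo2_henon_iter_inv]) simp
  have g: "holo2 UNIV g" unfolding g_def by (rule holo2_compose[OF holo2_henon_iter holo2_cmul]) simp
  have gD: "g x \<in> ball 0 1 \<longleftrightarrow> x \<in> ?D" for x
    unfolding D using \<rho> by (simp add: g_def norm_cmul norm_divide divide_simps)
  have img: "f ` ball 0 1 = ?D"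
  proof (intro set_eqI iffI)
    fix x assume "x \<in> f ` ball 0 1"
    then obtain y where "y \<in> ball 0 1" "x = f y" by blast
    then show "x \<in> ?D" using gD[of x] gf[of y] by simp
  next
    fix x assume "x \<in> ?D"
    then show "x \<in> f ` ball 0 1" using gD fg by (metis image_eqI)
  qed
  then have "g ` ?D = ball 0 1" by (metis (no_types, lifting) gf image_cong image_ident image_image)
  then show "biholomorphic (ball 0 1) ?D"
    unfolding biholomorphic_def using f g img fg gf \<open>open ?D\<close>
    by (intro exI[of _ f] exI[of _ g]) (auto intro: holo2_subset)
  have "connected ?D"
    unfolding img[symmetric] using holo2_continuous_on[OF f]
    by (intro connected_continuous_image) (auto intro: continuous_on_subset convex_connected)
  moreover have "?D \<noteq> {}" unfolding img[symmetric] by simp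
  ultimately show "domain2 ?D" using \<open>open ?D\<close> by (simp add: domain2_def)
qed

lemma exhaustion:
  assumes "r > 0"
  obtains D :: "nat \<Rightarrow> (complex \<times> complex) set"
  where "\<And>n. D n \<subseteq> D (Suc n)" "(\<Union>n. D n) = {p. G p < r}"
    "\<And>n. domain2 (D n)" "\<And>n. biholomorphic (ball 0 1) (D n)"
proof -
  \<comment> \<open>The sets are known to be balls only once \<open>r * d ^ n\<close> exceeds
    \<open>ln K\<close>; dropping the first \<open>N\<close> of them leaves the increasing union
    unchanged.\<close>
  obtain N where N: "\<And>n. n \<ge> N \<Longrightarrow> r * real d ^ n > ln K"
    using eventually_pow_gt[OF assms] unfolding eventually_sequentially by blast
  show ?thesis
  proof (rule that[of "\<lambda>n. {p. a (n + N) p < r}"])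
    show "{p. a (n + N) p < r} \<subseteq> {p. a (Suc n + N) p < r}" for n
      using a_Suc_le[of "n + N"] by (auto intro: le_less_trans)
    have "a (n + N) p < r" if "a n p < r" for n p
      using decseqD[OF a_decseq[of p], of n "n + N"] that by linarith
    then show "(\<Union>n. {p. a (n + N) p < r}) = {p. G p < r}"
      by (auto simp: G_less_iff)
  qed (use N biholomorphic_sublevel in auto)
qed

lemma domain2_sublevel:
  assumes "r > 0"
  shows "domain2 {p. G p < r}"
proof -
  obtain D :: "nat \<Rightarrow> (complex \<times> complex) set"
    where D: "\<And>n. D n \<subseteq> D (Suc n)" "(\<Union>n. D n) = {p. G p < r}" "\<And>n. domain2 (D n)"
    using exhaustion[OF assms] by metis
  have "open (\<Union>n. D n)" using D(3) by (auto simp: domain2_def)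
  \<comment> \<open>All \<open>D n\<close> share the nonempty set \<open>D 0\<close>, hence their
    union is connected.\<close>
  moreover have "D 0 \<subseteq> D n" for n using lift_Suc_mono_le[of D, OF D(1)] by blast
  then have "connected (\<Union>n. D n)"
  proof (intro connected_Union)
    show "\<Inter>(range D) \<noteq> {}" using \<open>\<And>n. D 0 \<subseteq> D n\<close> D(3)[of 0] unfolding domain2_def by blast
  qed (use D(3) in \<open>auto simp: domain2_def\<close>)
  moreover have "(\<Union>n. D n) \<noteq> {}" using D(3)[of 0] by (auto simp: domain2_def)
  ultimately show ?thesis unfolding D(2)[symmetric] by (simp add: domain2_def)
qed

subsection \<open>Vanishing of the Kobayashi--Royden pseudometric\<close>

text \<open>If \<open>a m < r' < r\<close> near \<open>p\<close>, Cauchy's estimate bounds \<open>v\<^sub>n = DF\<^sub>n(p) v\<close> by a multiple of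
  \<open>exp (r' d\<^sup>n)\<close>, so that the affine disc \<open>\<zeta> \<mapsto> F\<^sub>n(p) + \<zeta> v\<^sub>n\<close> of any prescribed radius eventually stays
  in the ball of radius \<open>exp (r d\<^sup>n - ln K)\<close>; pull it back by \<open>F\<^sub>n\<close>.\<close>

lemma large_disc:
  assumes p: "G p < r" and \<rho>: "\<rho> > 0"
  shows "\<exists>\<phi> :: complex \<Rightarrow> complex \<times> complex.
      (\<lambda>\<zeta>. fst (\<phi> \<zeta>)) holomorphic_on ball 0 \<rho> \<and> (\<lambda>\<zeta>. snd (\<phi> \<zeta>)) holomorphic_on ball 0 \<rho> \<and>
      \<phi> ` ball 0 \<rho> \<subseteq> {p. G p < r} \<and> \<phi> 0 = p \<and>
      (deriv (\<lambda>\<zeta>. fst (\<phi> \<zeta>)) 0, deriv (\<lambda>\<zeta>. snd (\<phi> \<zeta>)) 0) = v"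
proof -
  obtain m where m: "a m p < r" using p G_less_iff by blast
  define r' where "r' = (a m p + r) / 2"
  have r': "a m p < r'" "r' < r" "r' > 0" using m a_nonneg[of m p] by (auto simp: r'_def)
  \<comment> \<open>The parameters on the complex line through \<open>p\<close> in direction
    \<open>v\<close> at which \<open>a m < r'\<close>. The radius \<open>s\<close> found here is
    fixed before \<open>n\<close>, and by monotonicity the bound persists for all
    \<open>n \<ge> m\<close>.\<close>
  define S where "S = (\<lambda>t. p + cmul t v) -` {x. a m x < r'}"
  have "open S"
    unfolding S_def
    by (intro open_vimage open_Collect_less continuous_on_a continuous_on_const)
      (auto intro!: continuous_intros simp: cmul_def)
  moreover have "0 \<in> S" using r' by (simp add: S_def)
  ultimately obtain s where s: "s > 0" "cball 0 s \<subseteq> S" using open_contains_cball by blast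
  have inv: "\<exists>L. (f has_derivative L) (at x) \<and> (\<forall>c v. L (cmul c v) = cmul c (L v))"
    if "holo2 UNIV f" for f x
    using that unfolding holo2_def by blast
  \<comment> \<open>In the factor, 1 accounts for the centre \<open>F n p\<close> and
    \<open>\<rho> * (2 / s)\<close> for the displacement: Cauchy's estimate bounds each of the two
    coordinates of \<open>w\<close> by \<open>B / s\<close>.\<close>
  have "\<forall>\<^sub>F n in sequentially. n \<ge> m \<and> r' * real d ^ n > ln K \<and>
      (1 + \<rho> * (2 / s)) * exp (r' * real d ^ n - ln K) < exp (r * real d ^ n - ln K)"
  proof (intro eventually_conj eventually_ge_at_top eventually_pow_gt r')
    have "\<forall>\<^sub>F n in sequentially. (r - r') * real d ^ n > ln (1 + \<rho> * (2 / s))"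
      using r' by (intro eventually_pow_gt) auto
    then show "\<forall>\<^sub>F n in sequentially. (1 + \<rho> * (2 / s)) * exp (r' * real d ^ n - ln K) < exp (r * real d ^ n - ln K)"
    proof eventually_elim
      case (elim n)
      have pos: "1 + \<rho> * (2 / s) > 0" using \<rho> s by (simp add: add_pos_pos)
      have "(1 + \<rho> * (2 / s)) * exp (r' * real d ^ n - ln K)
          = exp (ln (1 + \<rho> * (2 / s)) + (r' * real d ^ n - ln K))"
        using pos by (simp add: exp_add)
      also have "\<dots> < exp (r * real d ^ n - ln K)"
        using elim by (simp add: algebra_simps)
      finally show ?case .
    qed
  qed
  then obtain n where n: "n \<ge> m" "r' * real d ^ n > ln K"
    and large: "(1 + \<rho> * (2 / s)) * exp (r' * real d ^ n - ln K) < exp (r * real d ^ n - ln K)"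
    using eventually_happens' sequentially_bot by blast
  define B where "B = exp (r' * real d ^ n - ln K)"
  have n': "r * real d ^ n > ln K"
    using n(2) r' by (smt (verit) mult_right_mono of_nat_0_le_iff zero_le_power)
  have bound: "norm (F n (p + cmul t v)) < B" if "t \<in> cball 0 s" for t
  proof -
    have "a m (p + cmul t v) < r'" using that s by (auto simp: S_def)
    then have "a n (p + cmul t v) < r'"
      using decseqD[OF a_decseq[of "p + cmul t v"] n(1)] by linarith
    then show ?thesis using a_less_iff[OF n(2)] by (simp add: B_def)
  qed
  obtain L where L: "(F n has_derivative L) (at p)" "\<And>c v. L (cmul c v) = cmul c (L v)"
    using inv[OF holo2_henon_iter] by metis
  obtain L' where L': "(F_inv n has_derivative L') (at (F n p))" "\<And>c v. L' (cmul c v) = cmul c (L' v)"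
    using inv[OF holo2_henon_iter_inv] by metis
  \<comment> \<open>By the chain rule \<open>L'\<close> undoes \<open>L\<close>, so the disc pulled
    back from direction \<open>w = L v\<close> has derivative \<open>v\<close> at 0.\<close>
  have "((F_inv n \<circ> F n) has_derivative (L' \<circ> L)) (at p)"
    using L(1) L'(1) by (rule diff_chain_at)
  moreover have "F_inv n \<circ> F n = (\<lambda>x. x)" by (auto simp: F_inv_F)
  ultimately have "L' \<circ> L = (\<lambda>x. x)"
    using has_derivative_unique has_derivative_ident by metis
  then have L'L: "L' (L v) = v" by (metis comp_apply)
  define w where "w = L v"
  have cauchy: "norm (deriv h 0) \<le> B / s"
    if "h holomorphic_on UNIV" "\<And>t. t \<in> cball 0 s \<Longrightarrow> norm (h t) \<le> B" for h
  proof -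
    have "norm ((deriv ^^ 1) h 0) \<le> fact 1 * B / s ^ 1"
    proof (rule Cauchy_inequality)
      show "h holomorphic_on ball 0 s" using that(1) by (rule holomorphic_on_subset) simp
      show "continuous_on (cball 0 s) h"
        using holomorphic_on_imp_continuous_on[OF that(1)] by (rule continuous_on_subset) simp
    qed (use that(2) s in auto)
    then show ?thesis by simp
  qed
  have der: "deriv (\<lambda>t. fst (F n (p + cmul t v))) 0 = fst w" "deriv (\<lambda>t. snd (F n (p + cmul t v))) 0 = snd w"
    using holo2_line[where f = "F n" and p = p and t = 0 and v = v, OF _ L(2)] L(1)
    unfolding w_def by (simp_all add: DERIV_imp_deriv)
  have "norm (fst w) \<le> B / s"
    unfolding der[symmetric] by (rule cauchy, rule holo2_line_holomorphic(1)[OF holo2_henon_iter])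
      (rule order_trans[OF norm_fst_snd_le(1) less_imp_le[OF bound]])
  moreover have "norm (snd w) \<le> B / s"
    unfolding der[symmetric] by (rule cauchy, rule holo2_line_holomorphic(2)[OF holo2_henon_iter])
      (rule order_trans[OF norm_fst_snd_le(2) less_imp_le[OF bound]])
  ultimately have w: "norm w \<le> 2 / s * B"
    using norm_Pair_le[of "fst w" "snd w"] by simp
  define \<phi> where "\<phi> = (\<lambda>\<zeta>. F_inv n (F n p + cmul \<zeta> w))"
  have "\<phi> \<zeta> \<in> {p. G p < r}" if "\<zeta> \<in> ball 0 \<rho>" for \<zeta>
  proof -
    have "norm (F n (\<phi> \<zeta>)) \<le> norm (F n p) + norm \<zeta> * norm w"
      unfolding \<phi>_def F_F_inv by (metis norm_cmul norm_triangle_ineq)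
    also have "\<dots> \<le> B + \<rho> * (2 / s * B)"
      using that w bound[of 0] s \<rho> by (intro add_mono mult_mono) auto
    also have "\<dots> < exp (r * real d ^ n - ln K)"
      using large by (simp add: B_def algebra_simps)
    finally show ?thesis using a_less_iff[OF n'] G_less_iff by blast
  qed
  moreover have "\<phi> 0 = p" by (simp add: \<phi>_def F_inv_F)
  moreover have "(deriv (\<lambda>\<zeta>. fst (\<phi> \<zeta>)) 0, deriv (\<lambda>\<zeta>. snd (\<phi> \<zeta>)) 0) = v"
    using holo2_line[where f = "F_inv n" and p = "F n p" and t = 0 and v = w, OF _ L'(2)] L'(1) L'L
    unfolding \<phi>_def w_def by (simp add: DERIV_imp_deriv)
  moreover have "(\<lambda>\<zeta>. fst (\<phi> \<zeta>)) holomorphic_on ball 0 \<rho>" "(\<lambda>\<zeta>. snd (\<phi> \<zeta>)) holomorphic_on ball 0 \<rho>"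
    unfolding \<phi>_def by (rule holo2_line_holomorphic[OF holo2_henon_iter_inv])+
  ultimately show ?thesis by blast
qed

text \<open>Discs of every radius exist, so the infimum runs over all positive reals.\<close>

lemma kobayashi_royden_sublevel:
  assumes "G p < r"
  shows "kobayashi_royden {p. G p < r} p v = 0"
proof -
  have "{1 / r' | r'. r' > 0 \<and> (\<exists>\<phi> :: complex \<Rightarrow> complex \<times> complex.
      (\<lambda>\<zeta>. fst (\<phi> \<zeta>)) holomorphic_on ball 0 r' \<and> (\<lambda>\<zeta>. snd (\<phi> \<zeta>)) holomorphic_on ball 0 r' \<and>
      \<phi> ` ball 0 r' \<subseteq> {p. G p < r} \<and> \<phi> 0 = p \<and>
      (deriv (\<lambda>\<zeta>. fst (\<phi> \<zeta>)) 0, deriv (\<lambda>\<zeta>. snd (\<phi> \<zeta>)) 0) = v)} = {1 / r' | r'. r' > (0::real)}"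
    using large_disc[OF assms] by blast
  also have "\<dots> = {0<..}"
  proof (intro set_eqI iffI)
    fix x :: real assume "x \<in> {0<..}"
    then show "x \<in> {1 / r' | r'. r' > 0}" by (intro CollectI exI[of _ "1 / x"]) auto
  qed auto
  finally show ?thesis unfolding kobayashi_royden_def by (simp add: cInf_greaterThan)
qed

subsection \<open>Plurisubharmonicity and non-constancy of the Green function\<close>

text \<open>The inequality holds for each continuous \<open>a n\<close> and passes to the limit by
  dominated convergence with majorant \<open>a 0\<close>, which also supplies integrability of
  \<open>G\<close> on circles.\<close>

lemma G_submean: "2 * pi * G x \<le> integral {0..2*pi} (\<lambda>\<theta>. G (x + cmul (cis \<theta>) b))"
  and G_circle_integrable: "(\<lambda>\<theta>. G (x + cmul (cis \<theta>) b)) integrable_on {0..2*pi}"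
proof -
  let ?a = "\<lambda>n \<theta>. a n (x + cmul (cis \<theta>) b)"
  have cont: "continuous_on {0..2*pi} (?a n)" for n
    by (rule continuous_on_compose2[OF continuous_on_a[of UNIV]])
      (auto intro!: continuous_intros simp: cmul_def)
  have dom: "norm (?a n \<theta>) \<le> ?a 0 \<theta>" for n \<theta>
    using decseqD[OF a_decseq[of "x + cmul (cis \<theta>) b"], of 0 n] a_nonneg by simp
  have int: "?a n integrable_on {0..2*pi}" for n
    using cont by (rule integrable_continuous_interval)
  note lim = dominated_convergence[of ?a "{0..2*pi}" "?a 0" "\<lambda>\<theta>. G (x + cmul (cis \<theta>) b)",
      OF int int dom a_tendsto]
  show "(\<lambda>\<theta>. G (x + cmul (cis \<theta>) b)) integrable_on {0..2*pi}" by (rule lim(1))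
  have "2 * pi * G x \<le> integral {0..2*pi} (?a n)" for n
  proof -
    let ?f = "\<lambda>t. fst (F n (x + cmul t b))" and ?g = "\<lambda>t. snd (F n (x + cmul t b))"
    let ?l = "\<lambda>\<theta>. logplus (norm (F n (x + cmul (cis \<theta>) b)))"
    have l: "?l integrable_on {0..2*pi}"
    proof -
      have "?l = (\<lambda>\<theta>. real d ^ n * ?a n \<theta> - ln K)" using d2 by (auto simp: a_def)
      then show ?thesis using cont by (auto intro!: integrable_continuous_interval continuous_intros)
    qed
    have "2 * pi * logplus (norm (?f 0, ?g 0)) \<le> integral {0..2*pi} (\<lambda>\<theta>. logplus (norm (?f (cis \<theta>), ?g (cis \<theta>))))"
      by (rule logplus_norm_submean) (rule holo2_line_holomorphic[OF holo2_henon_iter])+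
    then have "2 * pi * logplus (norm (F n x)) \<le> integral {0..2*pi} ?l" by simp
    then have "2 * pi * (logplus (norm (F n x)) + ln K) \<le> integral {0..2*pi} (\<lambda>\<theta>. ?l \<theta> + ln K)"
      using l by (subst integral_add) (auto simp: algebra_simps)
    then have "2 * pi * (logplus (norm (F n x)) + ln K) / real d ^ n
        \<le> integral {0..2*pi} (\<lambda>\<theta>. ?l \<theta> + ln K) / real d ^ n"
      by (intro divide_right_mono) auto
    also have "\<dots> = integral {0..2*pi} (?a n)" unfolding a_def by simp
    finally have "2 * pi * a n x \<le> integral {0..2*pi} (?a n)" by (simp add: a_def)
    moreover have "2 * pi * G x \<le> 2 * pi * a n x" using G_le_a by simp
    ultimately show ?thesis by linarith
  qed
  then show "2 * pi * G x \<le> integral {0..2*pi} (\<lambda>\<theta>. G (x + cmul (cis \<theta>) b))"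
    by (intro LIMSEQ_le_const[OF lim(2)]) auto
qed

text \<open>\<open>G\<close> is the pointwise infimum of the continuous functions
  \<open>a n\<close>.\<close>

lemma usc_on_G: "usc_on S G"
  unfolding usc_on_def
proof (intro ballI allI impI)
  fix x t assume "G x < t"
  then obtain n where "a n x < t" using G_less_iff by blast
  moreover have "open {y. a n y < t}"
    by (rule open_Collect_less) (auto intro: continuous_on_a)
  ultimately have "\<forall>\<^sub>F y in nhds x. y \<in> {y. a n y < t}"
    by (intro eventually_nhds_in_open) auto
  then show "\<forall>\<^sub>F y in at x within S. G y < t"
    unfolding eventually_at_filter
  proof eventually_elim
    case (elim y)
    then show ?case using G_le_a[of y n] by (auto intro: le_less_trans)
  qed
qed

lemma psh_on_G: "psh_on S G"
  unfolding psh_on_def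
proof (intro conjI allI impI usc_on_G)
  fix x b M assume M: "\<forall>\<theta>. G (x + cmul (cis \<theta>) b) \<le> M"
  let ?G = "\<lambda>\<theta>. G (x + cmul (cis \<theta>) b)"
  have I: "((\<lambda>\<theta>. M - ?G \<theta>) has_integral (2 * pi * M - integral {0..2*pi} ?G)) {0..2*pi}"
    using has_integral_diff[OF has_integral_const_real[of M 0 "2*pi"]
        integrable_integral[OF G_circle_integrable[of x b]]] by simp
  \<comment> \<open>Yields \<open>G x \<le> M\<close>, without which
    \<open>ennreal (M - G x)\<close> would be cut off at 0.\<close>
  have "0 \<le> 2 * pi * M - integral {0..2*pi} ?G"
    using M by (intro has_integral_nonneg[OF I]) auto
  with G_submean[of x b] have "2 * pi * G x \<le> 2 * pi * M" by linarith
  then show "G x \<le> M" by simp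
  have "(\<integral>\<^sup>+ \<theta>. ennreal (M - ?G \<theta>) * indicator {0..2*pi} \<theta> \<partial>lborel)
      = ennreal (2 * pi * M - integral {0..2*pi} ?G)"
    using M by (intro nn_integral_has_integral_lebesgue'[OF _ I]) auto
  also have "\<dots> \<le> ennreal (2 * pi * (M - G x))"
    using G_submean[of x b] by (intro ennreal_leI) (simp add: algebra_simps)
  also have "\<dots> = ennreal (2 * pi) * ennreal (M - G x)"
    using \<open>G x \<le> M\<close> by (intro ennreal_mult) auto
  finally show "(\<integral>\<^sup>+ \<theta>. ennreal (M - ?G \<theta>) * indicator {0..2*pi} \<theta> \<partial>lborel)
      \<le> ennreal (2 * pi) * ennreal (M - G x)" .
qed

section \<open>Escaping orbits and lower bounds for the Green function\<close>

definition R :: real where "R = 4 + 2 * (d + 1) * M"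

lemma R_ge: "R \<ge> 4" "R \<ge> 2 * (d + 1) * M"
  using M_nonneg by (simp_all add: R_def)

text \<open>In this region the terms other than the leading power add up to at most
  \<open>(d + 1) * M * x ^ (d - 1)\<close> with \<open>x = norm (fst p)\<close>, which is at most
  half of \<open>x ^ d\<close> because \<open>x \<ge> R \<ge> 2 * (d + 1) * M\<close>.\<close>

lemma norm_fst_henon_ge:
  assumes "n \<ge> 1" "norm (fst p) \<ge> R" "norm (snd p) \<le> norm (fst p)"
  shows "norm (fst (henon d (q n) (\<delta> n) p)) \<ge> norm (fst p) ^ d / 2"
proof -
  let ?x = "norm (fst p)"
  have x: "?x \<ge> 1" using R_ge assms by linarith
  have xd: "?x ^ d = ?x * ?x ^ (d - 1)" using d2 by (cases d) auto
  have "?x \<le> ?x ^ (d - 1)" using x d2 by (intro self_le_power) auto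
  have "?x ^ d = norm (fst p ^ d)" by (simp add: norm_power)
  also have "\<dots> \<le> norm (fst (henon d (q n) (\<delta> n) p)) + norm (poly (q n) (fst p)) + norm (\<delta> n * snd p)"
    unfolding henon_def fst_conv
    using norm_triangle_ineq4[of "fst p ^ d + poly (q n) (fst p) + \<delta> n * snd p" "poly (q n) (fst p) + \<delta> n * snd p"]
      norm_triangle_ineq[of "poly (q n) (fst p)" "\<delta> n * snd p"] by simp
  also have "norm (poly (q n) (fst p)) \<le> d * M * ?x ^ (d - 1)"
    using assms x by (intro norm_poly_le) auto
  also have "norm (\<delta> n * snd p) \<le> M * ?x ^ (d - 1)"
    unfolding norm_mult using \<delta>_le[OF assms(1)] assms(3) \<open>?x \<le> ?x ^ (d - 1)\<close> M_nonneg
    by (intro mult_mono) auto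
  finally have 1: "?x ^ d \<le> norm (fst (henon d (q n) (\<delta> n) p)) + (d + 1) * M * ?x ^ (d - 1)"
    by (simp add: algebra_simps)
  have "2 * (d + 1) * M * ?x ^ (d - 1) \<le> ?x * ?x ^ (d - 1)"
    using R_ge assms by (intro mult_right_mono) auto
  then show ?thesis using 1 xd by (simp add: algebra_simps)
qed

text \<open>The lower bound is chosen so that it is reproduced by \<open>x \<mapsto> x\<^sup>d / 2\<close>.\<close>

lemma orbit_growth:
  assumes "F n p = (of_real R, 0)"
  shows "norm (snd (F (n + k) p)) \<le> norm (fst (F (n + k) p)) \<and> R \<le> norm (fst (F (n + k) p)) \<and>
    2 * 2 ^ (d ^ k) \<le> norm (fst (F (n + k) p))"
proof (induction k)
  case 0
  \<comment> \<open>At \<open>k = 0\<close> the bound reads \<open>2 * 2 ^ 1 = 4\<close>, whence the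
    summand 4 in \<open>R\<close>.\<close>
  show ?case using assms R_ge by simp
next
  case (Suc k)
  let ?p = "F (n + k) p"
  let ?x = "norm (fst ?p)"
  have step: "F (n + Suc k) p = henon d (q (Suc (n + k))) (\<delta> (Suc (n + k))) ?p" by simp
  have x: "?x \<ge> 2" using R_ge Suc by linarith
  have ge: "?x ^ d / 2 \<le> norm (fst (F (n + Suc k) p))"
    unfolding step using Suc by (intro norm_fst_henon_ge) auto
  \<comment> \<open>From \<open>2 * ?x \<le> ?x ^ d\<close> the first coordinate does not shrink; as
    it becomes the next second coordinate, the orbit stays in the escape region.\<close>
  have "2 * ?x \<le> ?x ^ 2" using x unfolding power2_eq_square by (intro mult_right_mono) auto
  also have "?x ^ 2 \<le> ?x ^ d" using x d2 by (intro power_increasing) auto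
  finally have ge': "?x \<le> norm (fst (F (n + Suc k) p))" using ge by linarith
  have "(2::real) ^ 2 \<le> 2 ^ d" using d2 by (intro power_increasing) auto
  then have "2 * 2 ^ (d ^ Suc k) \<le> 2 ^ d * (2::real) ^ (d ^ Suc k) / 2" by simp
  also have "\<dots> = (2 * 2 ^ (d ^ k)) ^ d / 2"
    by (simp add: power_mult_distrib mult.commute flip: power_mult)
  also have "\<dots> \<le> ?x ^ d / 2" using Suc by (intro divide_right_mono power_mono) auto
  finally have "2 * 2 ^ (d ^ Suc k) \<le> norm (fst (F (n + Suc k) p))" using ge by linarith
  moreover have "snd (F (n + Suc k) p) = fst ?p" unfolding step by (simp add: henon_def)
  ultimately show ?case using ge' Suc by simp
qed

text \<open>The upper bound is \<open>G p \<le> a n p\<close>, evaluated where the iterate has norm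
  \<open>R\<close>. The lower bound comes from the growth \<open>2 ^ (d ^ k)\<close> after time
  \<open>n\<close>, divided by \<open>d ^ (n + k)\<close>.\<close>

lemma G_escaping_bounds:
  assumes "F n p = (of_real R, 0)"
  shows "ln 2 / real d ^ n \<le> G p" "G p \<le> (ln R + ln K) / real d ^ n"
proof -
  show "G p \<le> (ln R + ln K) / real d ^ n"
    using G_le_a[of p n] R_ge by (simp add: a_def assms logplus_def)
  have "ln 2 / real d ^ n \<le> a (n + k) p" for k
  proof -
    let ?y = "norm (F (n + k) p)"
    have "2 ^ (d ^ k) \<le> norm (fst (F (n + k) p))"
      using orbit_growth[OF assms, of k] zero_le_power[of "2::real" "d ^ k"] by linarith
    also have "\<dots> \<le> ?y" by (rule norm_fst_snd_le)
    finally have "ln (2 ^ (d ^ k)) \<le> ln (max 1 ?y)" by (intro ln_mono) auto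
    moreover have "ln K \<ge> 0" using K_ge by simp
    ultimately have "real d ^ k * ln 2 \<le> logplus ?y + ln K"
      unfolding logplus_eq by (simp add: ln_realpow)
    then have "real d ^ k * ln 2 / real d ^ (n + k) \<le> a (n + k) p"
      unfolding a_def by (intro divide_right_mono) auto
    then show ?thesis using d2 by (simp add: power_add)
  qed
  moreover have "(\<lambda>k. a (n + k) p) \<longlonglongrightarrow> G p"
    using LIMSEQ_ignore_initial_segment[OF a_tendsto, of n] by (simp add: add.commute)
  ultimately show "ln 2 / real d ^ n \<le> G p" by (meson LIMSEQ_le_const)
qed

text \<open>At the preimage of \<open>(R, 0)\<close> under \<open>F n\<close> the value of
  \<open>G\<close> is positive but tends to 0 as \<open>n\<close> grows, so two distinct values
  below \<open>r\<close> occur.\<close>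

lemma G_not_constant:
  assumes "r > 0"
  shows "\<not> (\<exists>c. \<forall>x\<in>{p. G p < r}. G x = c)"
proof
  have small: "\<exists>x. 0 < G x \<and> G x < e" if "e > 0" for e
  proof -
    obtain n where n: "e * real d ^ n > ln R + ln K"
      using eventually_happens'[OF sequentially_bot eventually_pow_gt[OF \<open>e > 0\<close>, of "ln R + ln K"]] by blast
    let ?x = "F_inv n (of_real R, 0)"
    have "0 < ln 2 / real d ^ n" using d2 by simp
    moreover have "(ln R + ln K) / real d ^ n < e" using n d2 by (simp add: divide_less_eq)
    ultimately show ?thesis
      using G_escaping_bounds[OF F_F_inv, of n] by (intro exI[of _ ?x]) linarith
  qed
  obtain x where x: "0 < G x" "G x < r" using small[OF assms] by blast
  obtain y where y: "G y < G x" using small[OF x(1)] by blast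
  assume "\<exists>c. \<forall>x\<in>{p. G p < r}. G x = c"
  then obtain c where c: "\<And>z. G z < r \<Longrightarrow> G z = c" by blast
  have "G y < r" using x y by linarith
  then show False using y c[OF x(2)] c[of y] by linarith
qed

lemma short_C2_sublevel:
  assumes "r > 0"
  shows "short_C2 {p. G p < r}"
  unfolding short_C2_def
proof (intro conjI)
  show "domain2 {p. G p < r}" using assms by (rule domain2_sublevel)
  show "\<exists>D. (\<forall>n. D n \<subseteq> D (Suc n)) \<and> (\<Union>n. D n) = {p. G p < r} \<and>
      (\<forall>n. domain2 (D n) \<and> biholomorphic (ball 0 1) (D n))"
  proof -
    obtain D :: "nat \<Rightarrow> (complex \<times> complex) set"
      where "\<And>n. D n \<subseteq> D (Suc n)" "(\<Union>n. D n) = {p. G p < r}"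
        "\<And>n. domain2 (D n)" "\<And>n. biholomorphic (ball 0 1) (D n)"
      by (rule exhaustion[OF assms]) (rule that)
    then show ?thesis by (intro exI[of _ D] conjI allI)
  qed
  show "\<forall>p\<in>{p. G p < r}. \<forall>v. kobayashi_royden {p. G p < r} p v = 0"
    by (simp add: kobayashi_royden_sublevel)
  show "\<exists>u. psh_on {p. G p < r} u \<and> (\<exists>C. \<forall>x\<in>{p. G p < r}. u x \<le> C) \<and>
      \<not> (\<exists>c. \<forall>x\<in>{p. G p < r}. u x = c)"
    using G_not_constant[OF assms] by (intro exI[of _ G] exI[of _ r] conjI psh_on_G) (simp_all add: less_imp_le)
qed

end

theorem theorem1p6:
  fixes d :: nat and q :: "nat \<Rightarrow> complex poly" and \<delta> :: "nat \<Rightarrow> complex"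
  assumes "d \<ge> 2"
    and "\<forall>n\<ge>1. degree (q n) \<le> d - 1"
    and "\<forall>n\<ge>1. \<delta> n \<noteq> 0"
    and "\<exists>M. \<forall>n\<ge>1. norm (\<delta> n) \<le> M \<and> (\<forall>i. norm (coeff (q n) i) \<le> M)"
  shows "\<forall>r>0. short_C2 {p. green_plus d q \<delta> p < r}"
proof -
  obtain M where "\<forall>n\<ge>1. norm (\<delta> n) \<le> M \<and> (\<forall>i. norm (coeff (q n) i) \<le> M)"
    using assms(4) by blast
  then interpret bounded_henon_sequence d q \<delta> M
    using assms(1-3) by unfold_locales auto
  show ?thesis using short_C2_sublevel by blast
qed

end
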